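(* Let $S,n$ be positive integers and let $Q=(q_1,\dots,q_S)\in\mathcal{M}_S$ be a fixed (known) distribution. Under the Poisson sampling model, the plug-in (maximum likelihood) estimator $\|P_n-Q\|_1=\sum_{i=1}^S|\hat p_i-q_i|$ satisfies $$\sup_{P\in\mathcal{M}_S}\mathbb{E}_P\big|\|P_n-Q\|_1-\|P-Q\|_1\big|^2\le 4\left(\sum_{i=1}^S q_i\wedge\sqrt{\frac{q_i}{n}}\right)^2+\frac1n,$$ and $$\sup_{P\in\mathcal{M}_S}\mathbb{E}_P\big|\|P_n-Q\|_1-\|P-Q\|_1\big|^2\ge \frac12\left(\sum_{i=1}^S q_i\wedge\sqrt{\frac{q_i}{n}}\right)^2.$$
   Context: $\mathcal{M}_S$ is the set of probability vectors $(p_1,\dots,p_S)$ on $\{1,\dots,S\}$; $\|P-Q\|_1=\sum_{i=1}^S|p_i-q_i|$; $a\wedge b=\min\{a,b\}$. Poisson sampling model: for $P=(p_1,\dots,p_S)$ one observes mutually independent $X_i\sim\mathrm{Poi}(np_i)$, $1\le i\le S$, and sets $\hat p_i=X_i/n$, $P_n=(\hat p_1,\dots,\hat p_S)$. $\mathbb{E}_P$ is expectation under this model ($\mathrm{Poi}(0)$ is the point mass at $0$). *)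

theory Defs
  imports "HOL-Probability.Probability"
begin

text \<open>
  Vectors indexed by \<open>1, \<dots>, S\<close> are functions on \<open>nat\<close> of which only the values on \<open>{1..S}\<close>
  matter; values outside are left unconstrained.
\<close>

definition prob_vectors :: "nat \<Rightarrow> (nat \<Rightarrow> real) set" where
  "prob_vectors S = {p. (\<forall>i\<in>{1..S}. 0 \<le> p i) \<and> (\<Sum>i=1..S. p i) = 1}"

definition l1_dist :: "nat \<Rightarrow> (nat \<Rightarrow> real) \<Rightarrow> (nat \<Rightarrow> real) \<Rightarrow> real" where
  "l1_dist S p q = (\<Sum>i=1..S. \<bar>p i - q i\<bar>)"

text \<open>The library's \<^const>\<open>poisson_pmf\<close> is specified for positive rates only.\<close>

definition poi :: "real \<Rightarrow> nat pmf" where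
  "poi r = (if r = 0 then return_pmf 0 else poisson_pmf r)"

text \<open>
  Joint law of the counts \<open>X\<^sub>1, \<dots>, X\<^sub>S\<close>: a product measure, so the coordinates are independent
  (\<open>indep_vars_Pi_pmf\<close>) with marginals \<open>poi (n * p i)\<close> (\<open>Pi_pmf_component\<close>). The second
  argument of \<^const>\<open>Pi_pmf\<close> is the irrelevant value of the counts outside \<open>{1..S}\<close>.
\<close>

definition poisson_sampling :: "nat \<Rightarrow> nat \<Rightarrow> (nat \<Rightarrow> real) \<Rightarrow> (nat \<Rightarrow> nat) pmf" where
  "poisson_sampling S n p = Pi_pmf {1..S} 0 (\<lambda>i. poi (real n * p i))"

definition empirical :: "nat \<Rightarrow> (nat \<Rightarrow> nat) \<Rightarrow> nat \<Rightarrow> real" where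
  "empirical n x = (\<lambda>i. real (x i) / real n)"

text \<open>
  The expectation of the nonnegative squared error is taken in \<open>[0, \<infinity>]\<close>, so that no integrability
  condition is presupposed and the supremum over \<open>P\<close> is a genuine one.
\<close>

definition plugin_risk :: "nat \<Rightarrow> nat \<Rightarrow> (nat \<Rightarrow> real) \<Rightarrow> (nat \<Rightarrow> real) \<Rightarrow> ennreal" where
  "plugin_risk S n q p =
     (\<integral>\<^sup>+ x. ennreal (\<bar>l1_dist S (empirical n x) q - l1_dist S p q\<bar>\<^sup>2)
        \<partial>measure_pmf (poisson_sampling S n p))"

end

theory Submission
  imports Defs
begin

text \<open>
  Write \<open>W\<^sub>i = \<bar>X\<^sub>i / n - q\<^sub>i\<bar> - \<bar>p\<^sub>i - q\<^sub>i\<bar>\<close> for the error of coordinate \<open>i\<close>. The \<open>W\<^sub>i\<close> are independent, so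
  the risk at \<open>P\<close> is the squared bias \<open>(\<Sum>i. E W\<^sub>i)\<^sup>2\<close> plus the sum of the variances
  (\<open>sum_coordinates_Pi_pmf_second_moment_le\<close>), and everything reduces to moments of one Poisson
  variable \<open>X\<close> of mean \<open>r = n p\<close>, compared with the threshold \<open>t = n q\<close>.

  Upper bound. The reverse triangle inequality gives \<open>\<bar>W\<^sub>i\<bar> \<le> \<bar>X\<^sub>i / n - p\<^sub>i\<bar>\<close>, so the variances add up to at
  most \<open>\<Sum>i. p\<^sub>i / n = 1 / n\<close>. The bias of a coordinate is nonnegative by Jensen, and it is at most
  \<open>2 min q\<^sub>i (sqrt (q\<^sub>i / n))\<close>, whatever \<open>p\<^sub>i\<close> is (\<open>poi_mean_abs_shift_le\<close>). For the
  first term of the minimum, \<open>\<bar>x - t\<bar> \<le> x + t\<close> is enough. For the second one, if \<open>r \<le> t\<close> then the standard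
  deviation \<open>sqrt r \<le> sqrt t\<close> bounds the bias. If \<open>r > t\<close>, then \<open>\<bar>x - t\<bar> = (x - t) + 2 max 0 (t - x)\<close>
  shows that only the mass of \<open>X\<close> below \<open>t\<close> produces bias; falling below \<open>t\<close> is then a deviation by at
  least \<open>r - t\<close> from the mean, which grows faster than the standard deviation, and the contribution of
  this mass stays of order \<open>sqrt t\<close> for all \<open>r\<close>.

  Lower bound. Take \<open>P = Q\<close>. By Jensen the risk is at least \<open>(\<Sum>i. E \<bar>X\<^sub>i / n - q\<^sub>i\<bar>)\<^sup>2\<close>, so it suffices that
  a Poisson variable of mean \<open>r\<close> has mean absolute deviation at least \<open>min r (sqrt r) / sqrt 2\<close>
  (\<open>poi_mean_abs_deviation_lower_bound\<close>). De Moivre's telescoping sum turns the mean absolute deviation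
  into a point mass, \<open>2 r Pr (X = m)\<close> with \<open>m = \<lfloor>r\<rfloor>\<close>, and \<open>sqrt r Pr (X = m) \<ge> exp (- 1)\<close> for \<open>r \<ge> 1\<close>.
  The constant \<open>1 / 2\<close> of the theorem comes out because \<open>2 exp (- 1) \<ge> 1 / sqrt 2\<close>, that is
  \<open>exp 1 \<le> 2 sqrt 2\<close>.
\<close>

section \<open>Moments of the Poisson distribution\<close>

lemma pmf_poi:
  assumes "0 \<le> r"
  shows "pmf (poi r) k = r ^ k / fact k * exp (- r)"
  using assms by (cases k) (auto simp: poi_def)

text \<open>
  This recursion of the weights is behind both the moment identities and the telescoping sum below.
\<close>

lemma pmf_poi_Suc:
  assumes "0 \<le> r"
  shows "real (Suc k) * pmf (poi r) (Suc k) = r * pmf (poi r) k"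
  using assms by (simp add: pmf_poi divide_simps)

text \<open>
  The Chen--Stein identity \<open>E (X f(X)) = r E (f(X + 1))\<close>. With values in \<open>[0, \<infinity>]\<close> it
  yields the moments together with their finiteness.
\<close>

lemma nn_integral_poi_Suc:
  fixes f :: "nat \<Rightarrow> ennreal"
  assumes "0 \<le> r"
  shows "(\<integral>\<^sup>+k. ennreal (real k) * f k \<partial>poi r) = ennreal r * (\<integral>\<^sup>+k. f (Suc k) \<partial>poi r)"
proof -
  have "(\<integral>\<^sup>+k. ennreal (real k) * f k \<partial>poi r)
      = (\<Sum>k. ennreal (pmf (poi r) k) * (ennreal (real k) * f k))"
    by (simp add: nn_integral_measure_pmf nn_integral_count_space_nat)
  also have "\<dots> = (\<Sum>k. ennreal (pmf (poi r) (Suc k)) * (ennreal (real (Suc k)) * f (Suc k)))"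
    by (subst suminf_offset[where i = 1]) auto
  also have "\<dots> = (\<Sum>k. ennreal r * (ennreal (pmf (poi r) k) * f (Suc k)))"
  proof (rule suminf_cong)
    fix k
    have "ennreal (pmf (poi r) (Suc k)) * ennreal (real (Suc k))
        = ennreal r * ennreal (pmf (poi r) k)"
      using pmf_poi_Suc[OF assms, of k] assms
      by (simp add: ennreal_mult[symmetric] mult.commute del: of_nat_Suc)
    then show "ennreal (pmf (poi r) (Suc k)) * (ennreal (real (Suc k)) * f (Suc k))
        = ennreal r * (ennreal (pmf (poi r) k) * f (Suc k))"
      by (simp add: mult.assoc[symmetric])
  qed
  also have "\<dots> = ennreal r * (\<integral>\<^sup>+k. f (Suc k) \<partial>poi r)"
    by (simp add: nn_integral_measure_pmf nn_integral_count_space_nat)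
  finally show ?thesis .
qed

lemma nn_integral_poi_real:
  assumes "0 \<le> r"
  shows "(\<integral>\<^sup>+k. ennreal (real k) \<partial>poi r) = ennreal r"
  using nn_integral_poi_Suc[OF assms, of "\<lambda>_. 1"] by simp

lemma poi_first_moment:
  assumes "0 \<le> r"
  shows "has_bochner_integral (poi r) real r"
  using assms by (intro has_bochner_integral_nn_integral) (auto simp: nn_integral_poi_real)

lemma poi_second_moment:
  assumes "0 \<le> r"
  shows "has_bochner_integral (poi r) (\<lambda>k. (real k)\<^sup>2) (r\<^sup>2 + r)"
proof (rule has_bochner_integral_nn_integral)
  have "(\<integral>\<^sup>+k. ennreal ((real k)\<^sup>2) \<partial>poi r) = (\<integral>\<^sup>+k. ennreal (real k) * ennreal (real k) \<partial>poi r)"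
    by (simp add: power2_eq_square ennreal_mult)
  also have "\<dots> = ennreal r * (\<integral>\<^sup>+k. ennreal (real k) + 1 \<partial>poi r)"
    by (subst nn_integral_poi_Suc[OF assms]) (simp add: add.commute)
  also have "(\<integral>\<^sup>+k. ennreal (real k) + 1 \<partial>poi r) = ennreal r + 1"
    by (subst nn_integral_add) (simp_all add: nn_integral_poi_real assms)
  also have "ennreal r * (ennreal r + 1) = ennreal (r\<^sup>2 + r)"
    using assms by (simp add: distrib_left ennreal_mult power2_eq_square)
  finally show "(\<integral>\<^sup>+k. ennreal ((real k)\<^sup>2) \<partial>poi r) = ennreal (r\<^sup>2 + r)" .
qed (use assms in auto)

lemma poi_centered_second_moment:
  assumes "0 \<le> r"
  shows "has_bochner_integral (poi r) (\<lambda>k. (real k - c)\<^sup>2) (r + (r - c)\<^sup>2)"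
proof -
  have const: "has_bochner_integral (poi r) (\<lambda>_. c\<^sup>2) (c\<^sup>2)"
    by (simp add: has_bochner_integral_iff)
  have "has_bochner_integral (poi r) (\<lambda>k. (real k)\<^sup>2 - real k * (2 * c) + c\<^sup>2)
          (r\<^sup>2 + r - r * (2 * c) + c\<^sup>2)"
    using poi_first_moment[OF assms] poi_second_moment[OF assms] const
    by (intro has_bochner_integral_add has_bochner_integral_diff has_bochner_integral_mult_left)
  then show ?thesis
    by (simp add: power2_diff algebra_simps)
qed

lemma integrable_poi_abs:
  assumes "0 \<le> r"
  shows "integrable (poi r) (\<lambda>k. \<bar>real k - c\<bar>)"
  using poi_first_moment[OF assms] by (auto simp: has_bochner_integral_iff)

lemma poi_expectation_minus:
  assumes "0 \<le> r"
  shows "has_bochner_integral (poi r) (\<lambda>k. real k - c) (r - c)"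
  using poi_first_moment[OF assms] by (simp add: has_bochner_integral_iff)

section \<open>A lower bound for the mean absolute deviation\<close>

text \<open>
  De Moivre's identity: by the recursion of the weights, \<open>(r - k) Pr (X = k)\<close> is the difference of
  \<open>r Pr (X = k)\<close> and \<open>r Pr (X = k - 1)\<close>, so the sum telescopes.
\<close>

lemma poi_lower_partial_mean:
  assumes "0 \<le> r"
  shows "(\<Sum>k\<le>m. (r - real k) * pmf (poi r) k) = r * pmf (poi r) m"
proof (induction m)
  case (Suc m)
  then show ?case using pmf_poi_Suc[OF assms, of m] by (simp add: algebra_simps)
qed simp

text \<open>
  As \<open>X - r\<close> has mean zero, its absolute value has twice the expectation of its negative part.
  Truncating at an arbitrary \<open>m\<close> instead of at \<open>r\<close> can only decrease the latter; the bound is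
  sharp for \<open>m = \<lfloor>r\<rfloor>\<close>.
\<close>

lemma poi_mean_abs_deviation_ge:
  assumes "0 \<le> r"
  shows "2 * r * pmf (poi r) m \<le> measure_pmf.expectation (poi r) (\<lambda>k. \<bar>real k - r\<bar>)"
proof -
  let ?g = "\<lambda>k. (r - real k) * indicator {..m} k"
  have int: "integrable (poi r) ?g"
    using poi_first_moment[OF assms]
    by (intro integrable_real_mult_indicator) (auto simp: has_bochner_integral_iff)
  have "measure_pmf.expectation (poi r) ?g = (\<Sum>k\<le>m. ?g k * pmf (poi r) k)"
    by (rule integral_measure_pmf_real) (auto simp: indicator_def split: if_splits)
  also have "\<dots> = r * pmf (poi r) m"
    using poi_lower_partial_mean[OF assms, of m] by simp
  finally have g: "measure_pmf.expectation (poi r) ?g = r * pmf (poi r) m" .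
  have "2 * r * pmf (poi r) m = measure_pmf.expectation (poi r) (\<lambda>k. (real k - r) + 2 * ?g k)"
    using poi_expectation_minus[OF assms, of r] int g by (simp add: has_bochner_integral_iff)
  also have "\<dots> \<le> measure_pmf.expectation (poi r) (\<lambda>k. \<bar>real k - r\<bar>)"
    using poi_expectation_minus[OF assms, of r] int integrable_poi_abs[OF assms, of r]
    by (intro integral_mono) (auto simp: has_bochner_integral_iff indicator_def)
  finally show ?thesis .
qed

text \<open>
  Up to the factor \<open>fact m\<close>, the right-hand side at \<open>z = y\<close> is \<open>sqrt y Pr (X = m)\<close> for a Poisson
  variable of mean \<open>y\<close>; the left-hand side shows that its logarithm is concave in \<open>y\<close>.
\<close>

lemma exp_half_integer_mult_ln:
  fixes y :: real
  assumes "0 < y"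
  shows "exp ((real m + 1 / 2) * ln y - z) = sqrt y * (y ^ m * exp (- z))"
proof -
  have "(real m + 1 / 2) * ln y - z = ln (sqrt y) + (real m * ln y + - z)"
    using assms by (simp add: ln_sqrt algebra_simps)
  then have "exp ((real m + 1 / 2) * ln y - z) = exp (ln (sqrt y)) * (exp (real m * ln y) * exp (- z))"
    by (simp only: exp_add)
  then show ?thesis using assms by (simp add: exp_of_nat_mult)
qed

text \<open>
  The sequence on the right increases (to \<open>1 / sqrt (2 pi)\<close>, by Stirling's formula) and starts at
  \<open>exp (- 1)\<close> for \<open>m = 1\<close>. Monotonicity is the inequality \<open>(m + 1/2) ln (1 + 1/m) \<ge> 1\<close>.
\<close>

lemma sqrt_mult_pow_exp_div_fact_ge:
  assumes "1 \<le> m"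
  shows "exp (- 1) \<le> sqrt (real m) * (real m ^ m / fact m * exp (- real m))"
  using assms
proof (induction m rule: dec_induct)
  case (step m)
  let ?x = "real m"
  have x: "0 < ?x" using step.hyps by simp
  have "1 \<le> (?x + 1 / 2) * (ln (?x + 1) - ln ?x)"
  proof -
    have "1 = (?x + 1 / 2) * (2 * (?x + 1 - ?x) / (?x + (?x + 1)))"
      using x by (simp add: field_simps)
    also have "\<dots> \<le> (?x + 1 / 2) * (ln (?x + 1) - ln ?x)"
      using x by (intro mult_left_mono ln_inverse_approx_ge) auto
    finally show ?thesis .
  qed
  then have "exp ((?x + 1 / 2) * ln ?x - ?x) \<le> exp ((?x + 1 / 2) * ln (?x + 1) - (?x + 1))"
    by (simp add: right_diff_distrib)
  then have "sqrt ?x * (?x ^ m * exp (- ?x)) \<le> sqrt (?x + 1) * ((?x + 1) ^ m * exp (- (?x + 1)))"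
    using x by (simp only: exp_half_integer_mult_ln add_pos_pos zero_less_one)
  then have "sqrt ?x * (?x ^ m * exp (- ?x)) / fact m
      \<le> sqrt (?x + 1) * ((?x + 1) ^ m * exp (- (?x + 1))) / fact m"
    by (rule divide_right_mono) simp
  moreover have "(?x + 1) ^ m / fact m = (?x + 1) ^ Suc m / fact (Suc m)"
    using x by (simp add: divide_simps)
  ultimately have "sqrt ?x * (?x ^ m / fact m * exp (- ?x))
      \<le> sqrt (?x + 1) * ((?x + 1) ^ Suc m / fact (Suc m) * exp (- (?x + 1)))"
    by (metis (no_types, lifting) times_divide_eq_left times_divide_eq_right)
  with step.IH show ?case
    by (simp only: of_nat_Suc add.commute[of 1])
qed simp

text \<open>
  For fixed \<open>m\<close>, the logarithm of \<open>sqrt r Pr (X = m)\<close> is concave in \<open>r\<close>, so on \<open>[m, m + 1]\<close> its minimum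
  is at an endpoint. At both endpoints the value belongs to the sequence of the previous lemma, since
  a Poisson variable of mean \<open>m + 1\<close> gives the same probability to \<open>m\<close> and to \<open>m + 1\<close>.
\<close>

lemma pmf_poi_floor_ge:
  assumes "1 \<le> r"
  shows "exp (- 1) \<le> sqrt r * pmf (poi r) (nat \<lfloor>r\<rfloor>)"
proof -
  define m where "m = nat \<lfloor>r\<rfloor>"
  have m: "1 \<le> m" "real m \<le> r" "r \<le> real m + 1"
    using assms by (auto simp: m_def) linarith+
  let ?f = "\<lambda>x. (real m + 1 / 2) * ln x - x"
  have f: "sqrt x * (x ^ m / fact m * exp (- x)) = exp (?f x) / fact m" if "0 < x" for x
    using exp_half_integer_mult_ln[OF that, of m x] by simp
  have "concave_on {real m..real m + 1} ln"
    using m(1) ln_concave unfolding concave_on_def by (auto intro: convex_on_subset)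
  then have "concave_on {real m..real m + 1} ?f"
    by (intro concave_on_diff concave_on_cmul) (auto simp: convex_on_ident)
  then have "min (?f (real m)) (?f (real m + 1)) \<le> ?f r"
    using m by (intro concave_on_ge_min) auto
  then have "min (exp (?f (real m))) (exp (?f (real m + 1))) \<le> exp (?f r)"
    by (auto simp: min_def split: if_splits)
  then have "min (exp (?f (real m)) / fact m) (exp (?f (real m + 1)) / fact m) \<le> exp (?f r) / fact m"
    by (auto simp: min_def divide_simps split: if_splits)
  moreover have "exp (- 1) \<le> exp (?f (real m)) / fact m"
    using sqrt_mult_pow_exp_div_fact_ge[of m] f[of "real m"] m(1) by simp
  moreover have "exp (- 1) \<le> exp (?f (real m + 1)) / fact m"
  proof -
    have "(real m + 1) ^ Suc m / fact (Suc m) = (real m + 1) ^ m / fact m"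
      by (simp add: divide_simps)
    then show ?thesis
      using sqrt_mult_pow_exp_div_fact_ge[of "Suc m"] f[of "real m + 1"]
      by (simp add: add.commute del: fact_Suc power_Suc)
  qed
  ultimately have "exp (- 1) \<le> exp (?f r) / fact m" by linarith
  then show ?thesis
    using f[of r] pmf_poi[of r m] assms by (simp add: m_def)
qed

text \<open>
  The truncation point is \<open>\<lfloor>r\<rfloor>\<close>. For \<open>r < 1\<close> it is \<open>0\<close>, and \<open>Pr (X = 0) = exp (- r) \<ge> exp (- 1)\<close>;
  for \<open>r \<ge> 1\<close> the previous lemma applies. Both cases end at the same constant \<open>2 exp (- 1)\<close>.
\<close>

lemma poi_mean_abs_deviation_lower_bound:
  assumes "0 \<le> r"
  shows "min r (sqrt r) / sqrt 2 \<le> measure_pmf.expectation (poi r) (\<lambda>k. \<bar>real k - r\<bar>)"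
proof -
  have e: "1 / sqrt 2 \<le> 2 * exp (- 1 :: real)"
  proof -
    have "(exp 1 :: real) \<le> 2 * sqrt 2"
    proof (rule power2_le_imp_le)
      have "(exp 1 :: real)\<^sup>2 \<le> (272 / 100)\<^sup>2"
        using e_less_272 by (intro power_mono) auto
      then show "(exp 1 :: real)\<^sup>2 \<le> (2 * sqrt 2)\<^sup>2"
        by (simp add: power_mult_distrib power2_eq_square)
    qed simp
    then show ?thesis by (simp add: exp_minus field_simps)
  qed
  have "\<exists>m. min r (sqrt r) / sqrt 2 \<le> 2 * r * pmf (poi r) m"
  proof (cases "r < 1")
    case True
    have "min r (sqrt r) * (1 / sqrt 2) \<le> r * (2 * exp (- r))"
      using assms True e by (intro mult_mono order_trans[OF e]) auto
    then have "min r (sqrt r) / sqrt 2 \<le> 2 * r * pmf (poi r) 0"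
      using assms by (simp add: pmf_poi mult_ac)
    then show ?thesis ..
  next
    case False
    let ?m = "nat \<lfloor>r\<rfloor>"
    have "min r (sqrt r) * (1 / sqrt 2) \<le> sqrt r * (2 * (sqrt r * pmf (poi r) ?m))"
      using assms False pmf_poi_floor_ge[of r]
      by (intro mult_mono order_trans[OF e]) auto
    then have "min r (sqrt r) / sqrt 2 \<le> 2 * r * pmf (poi r) ?m"
      using assms by (simp add: mult_ac) (simp add: mult.assoc[symmetric])
    then show ?thesis ..
  qed
  then show ?thesis
    using poi_mean_abs_deviation_ge[OF assms] order_trans by blast
qed

section \<open>The bias of the absolute distance to a threshold\<close>

lemma poi_mean_abs_shift_ge:
  assumes "0 \<le> r"
  shows "\<bar>r - t\<bar> \<le> measure_pmf.expectation (poi r) (\<lambda>k. \<bar>real k - t\<bar>)"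
  using integral_abs_bound[of "measure_pmf (poi r)" "\<lambda>k. real k - t"]
  unfolding has_bochner_integral_integral_eq[OF poi_expectation_minus[OF assms]] .

text \<open>
  Bounds for the mean of \<open>\<bar>X - t\<bar>\<close> come from quadratic majorants of \<open>\<bar>x - t\<bar>\<close>. The majorant is
  written so that its expectation can be read off: the centred linear term integrates to zero.
\<close>

lemma poi_mean_abs_shift_le_quadratic:
  assumes "0 \<le> r"
    and "\<And>k. \<bar>real k - t\<bar> \<le> a * (real k - c)\<^sup>2 + b * (real k - r) + d"
  shows "measure_pmf.expectation (poi r) (\<lambda>k. \<bar>real k - t\<bar>) \<le> a * (r + (r - c)\<^sup>2) + d"
proof -
  have "measure_pmf.expectation (poi r) (\<lambda>k. \<bar>real k - t\<bar>)
      \<le> measure_pmf.expectation (poi r) (\<lambda>k. a * (real k - c)\<^sup>2 + b * (real k - r) + d)"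
    using assms poi_centered_second_moment[OF assms(1), of c]
      poi_expectation_minus[OF assms(1), of r] integrable_poi_abs[OF assms(1)]
    by (intro integral_mono) (auto simp: has_bochner_integral_iff)
  also have "\<dots> = a * (r + (r - c)\<^sup>2) + d"
    using poi_centered_second_moment[OF assms(1), of c] poi_expectation_minus[OF assms(1), of r]
    by (simp add: has_bochner_integral_iff)
  finally show ?thesis .
qed

text \<open>
  The bound \<open>2 t\<close> comes from \<open>\<bar>x - t\<bar> \<le> x + t\<close>, and it is the smaller one for \<open>t \<le> 1\<close>. For \<open>t \<ge> 1\<close> put
  \<open>s = sqrt t\<close>. If \<open>r \<le> t\<close>, the standard deviation \<open>sqrt r \<le> s\<close> bounds the bias, through
  \<open>\<bar>x - r\<bar> \<le> (x - r)\<^sup>2 / (2 s) + s / 2\<close>. If \<open>r > t\<close>, the bias is twice the mean of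
  \<open>max 0 (t - X)\<close>, and \<open>max 0 u \<le> (u + c)\<^sup>2 / (4 c)\<close> for every \<open>c > 0\<close>; here \<open>c\<close> must grow like
  \<open>r - t\<close> so that the quotient stays of order \<open>s\<close> although the second moment grows with \<open>r\<close>.
\<close>

lemma poi_mean_abs_shift_le:
  assumes "0 \<le> r" and "0 \<le> t"
  shows "measure_pmf.expectation (poi r) (\<lambda>k. \<bar>real k - t\<bar>) - \<bar>r - t\<bar> \<le> 2 * min t (sqrt t)"
proof -
  define E where "E = measure_pmf.expectation (poi r) (\<lambda>k. \<bar>real k - t\<bar>)"
  have "E \<le> (r - t) + 2 * t"
    using poi_mean_abs_shift_le_quadratic[of r t 0 0 1 "r + t"] assms by (simp add: E_def add.commute)
  then have linear: "E - \<bar>r - t\<bar> \<le> 2 * t" by linarith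
  have root: "E - \<bar>r - t\<bar> \<le> 2 * sqrt t" if t: "1 \<le> t"
  proof -
    define s where "s = sqrt t"
    have s: "1 \<le> s" "t = s\<^sup>2" using t by (simp_all add: s_def)
    show ?thesis
    proof (cases "r \<le> t")
      case True
      have "\<bar>real k - t\<bar> \<le> 1 / (2 * s) * (real k - r)\<^sup>2 + 0 * (real k - r) + (s / 2 + \<bar>r - t\<bar>)" for k
      proof -
        have "0 \<le> (\<bar>real k - r\<bar> - s)\<^sup>2" by simp
        then have "2 * s * \<bar>real k - r\<bar> \<le> (real k - r)\<^sup>2 + s\<^sup>2"
          by (simp add: power2_diff algebra_simps)
        then have "\<bar>real k - r\<bar> \<le> 1 / (2 * s) * (real k - r)\<^sup>2 + s / 2"
          using s(1) by (simp add: field_simps power2_eq_square)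
        then show ?thesis by linarith
      qed
      then have "E \<le> 1 / (2 * s) * r + (s / 2 + \<bar>r - t\<bar>)"
        using poi_mean_abs_shift_le_quadratic[OF assms(1), of t "1 / (2 * s)" r 0 "s / 2 + \<bar>r - t\<bar>"]
        by (simp add: E_def)
      moreover have "1 / (2 * s) * r \<le> s / 2"
        using True s by (simp add: field_simps power2_eq_square)
      ultimately show ?thesis using s(1) unfolding s_def[symmetric] by linarith
    next
      case False
      \<comment> \<open>In terms of the lower deviation \<open>r - x\<close>, this choice makes the square \<open>((r - x) + s)\<^sup>2\<close>.\<close>
      define c where "c = s + (r - t)"
      have c: "0 < c" using False s(1) by (simp add: c_def)
      have "\<bar>real k - t\<bar> \<le> 1 / (2 * c) * (real k - (r + s))\<^sup>2 + 1 * (real k - r) + (r - t)" for k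
      proof -
        define A where "A = 1 / (2 * c) * (real k - (r + s))\<^sup>2"
        have "0 \<le> (t - real k - c)\<^sup>2" by simp
        also have "\<dots> = (real k - (r + s))\<^sup>2 - 4 * c * (t - real k)"
          by (simp add: c_def power2_eq_square algebra_simps)
        finally have "2 * (t - real k) \<le> A"
          using c by (simp add: A_def field_simps)
        moreover have "0 \<le> A" using c by (simp add: A_def)
        ultimately show ?thesis unfolding A_def[symmetric] by (simp add: abs_if)
      qed
      then have "E \<le> 1 / (2 * c) * (r + s\<^sup>2) + (r - t)"
        using poi_mean_abs_shift_le_quadratic[OF assms(1), of t "1 / (2 * c)" "r + s" 1 "r - t"]
        by (simp add: E_def)
      moreover have "1 / (2 * c) * (r + s\<^sup>2) \<le> s"
      proof -
        \<comment> \<open>This is where \<open>t \<ge> 1\<close> enters: the excess of the variance \<open>r\<close> over \<open>s\<^sup>2\<close> is at most \<open>s (r - t)\<close>.\<close>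
        have "1 * (r - t) \<le> s * (r - t)" using s(1) False by (intro mult_right_mono) auto
        moreover have "0 \<le> s * (r - t)" using s(1) False by simp
        ultimately have "r + s\<^sup>2 \<le> 2 * c * s"
          using s(2) by (simp add: c_def algebra_simps power2_eq_square)
        then show ?thesis using c by (simp add: field_simps)
      qed
      ultimately show ?thesis using s(1) False unfolding s_def[symmetric] by linarith
    qed
  qed
  have "t \<le> sqrt t" if "t \<le> 1"
    using that assms(2) by (intro real_le_rsqrt) (simp add: power2_eq_square mult_left_le)
  then show ?thesis using linear root unfolding E_def[symmetric] by (cases "t \<le> 1") (auto simp: min_def)
qed

section \<open>Sums of functions of independent coordinates\<close>

text \<open>
  Bias-variance decomposition: by independence the mixed moments factor, so the second moment of the
  sum is the squared mean plus the variances, and each variance is at most the second moment.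
\<close>

lemma
  fixes f :: "'i \<Rightarrow> 'b \<Rightarrow> real"
  assumes "finite A"
    and sq: "\<And>i. i \<in> A \<Longrightarrow> integrable (measure_pmf (D i)) (\<lambda>y. (f i y)\<^sup>2)"
  shows sum_coordinates_Pi_pmf_integrable:
      "integrable (measure_pmf (Pi_pmf A d D)) (\<lambda>x. \<Sum>i\<in>A. f i (x i))"
    and sum_coordinates_Pi_pmf_expectation:
      "measure_pmf.expectation (Pi_pmf A d D) (\<lambda>x. \<Sum>i\<in>A. f i (x i))
        = (\<Sum>i\<in>A. measure_pmf.expectation (D i) (f i))"
    and sum_coordinates_Pi_pmf_square_integrable:
      "integrable (measure_pmf (Pi_pmf A d D)) (\<lambda>x. (\<Sum>i\<in>A. f i (x i))\<^sup>2)"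
    and sum_coordinates_Pi_pmf_second_moment_le:
      "measure_pmf.expectation (Pi_pmf A d D) (\<lambda>x. (\<Sum>i\<in>A. f i (x i))\<^sup>2)
        \<le> (\<Sum>i\<in>A. measure_pmf.expectation (D i) (f i))\<^sup>2
          + (\<Sum>i\<in>A. measure_pmf.expectation (D i) (\<lambda>y. (f i y)\<^sup>2))"
proof -
  let ?M = "measure_pmf (Pi_pmf A d D)"
  let ?e = "\<lambda>i. measure_pmf.expectation (D i) (f i)"
  let ?v = "\<lambda>i. measure_pmf.expectation (D i) (\<lambda>y. (f i y)\<^sup>2)"
  have marginal: "map_pmf (\<lambda>x. x i) (Pi_pmf A d D) = D i" if "i \<in> A" for i
    using that assms(1) by (simp add: Pi_pmf_component)
  have transfer_int: "integrable ?M (\<lambda>x. g (x i)) \<longleftrightarrow> integrable (measure_pmf (D i)) g"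
    if "i \<in> A" for i and g :: "'b \<Rightarrow> real"
    using integrable_map_pmf_eq[of "\<lambda>x. x i" "Pi_pmf A d D" g] marginal[OF that] by simp
  have transfer_exp: "measure_pmf.expectation (Pi_pmf A d D) (\<lambda>x. g (x i)) = measure_pmf.expectation (D i) g"
    if "i \<in> A" for i and g :: "'b \<Rightarrow> real"
    using integral_map_pmf[of "\<lambda>x. x i" "Pi_pmf A d D" g] marginal[OF that] by simp
  have int: "integrable (measure_pmf (D i)) (f i)" if "i \<in> A" for i
    by (rule measure_pmf.square_integrable_imp_integrable[OF _ sq[OF that]]) simp
  show "integrable ?M (\<lambda>x. \<Sum>i\<in>A. f i (x i))"
    using int transfer_int by (intro Bochner_Integration.integrable_sum) auto
  show "measure_pmf.expectation (Pi_pmf A d D) (\<lambda>x. \<Sum>i\<in>A. f i (x i)) = (\<Sum>i\<in>A. ?e i)"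
    using int by (subst Bochner_Integration.integral_sum) (auto simp: transfer_int transfer_exp)
  have indep: "prob_space.indep_vars ?M (\<lambda>_. borel) (\<lambda>i x. f i (x i)) A"
    by (rule prob_space.indep_vars_compose2[OF measure_pmf.prob_space_axioms indep_vars_Pi_pmf[OF assms(1)]]) simp
  have cross: "integrable ?M (\<lambda>x. f i (x i) * f j (x j)) \<and>
      measure_pmf.expectation (Pi_pmf A d D) (\<lambda>x. f i (x i) * f j (x j))
        = (if i = j then ?v i else ?e i * ?e j)" if ij: "i \<in> A" "j \<in> A" for i j
  proof (cases "i = j")
    case True
    then show ?thesis
      using transfer_int[OF ij(1), of "\<lambda>y. (f i y)\<^sup>2"] transfer_exp[OF ij(1), of "\<lambda>y. (f i y)\<^sup>2"] sq[OF ij(1)]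
      by (simp add: power2_eq_square)
  next
    case False
    have "prob_space.indep_vars ?M (\<lambda>_. borel) (\<lambda>i x. f i (x i)) {i, j}"
      using ij by (intro prob_space.indep_vars_subset[OF measure_pmf.prob_space_axioms indep]) auto
    moreover have "integrable ?M (\<lambda>x. f k (x k))" if "k \<in> {i, j}" for k
      using that ij int by (auto simp: transfer_int)
    ultimately have "integrable ?M (\<lambda>x. \<Prod>k\<in>{i, j}. f k (x k)) \<and>
        measure_pmf.expectation (Pi_pmf A d D) (\<lambda>x. \<Prod>k\<in>{i, j}. f k (x k))
          = (\<Prod>k\<in>{i, j}. measure_pmf.expectation (Pi_pmf A d D) (\<lambda>x. f k (x k)))"
      by (intro conjI prob_space.indep_vars_lebesgue_integral prob_space.indep_vars_integrable
            measure_pmf.prob_space_axioms) auto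
    then show ?thesis using False ij by (simp add: transfer_exp)
  qed
  have square: "(\<Sum>i\<in>A. f i (x i))\<^sup>2 = (\<Sum>i\<in>A. \<Sum>j\<in>A. f i (x i) * f j (x j))" for x
    by (simp add: power2_eq_square sum_product)
  show "integrable ?M (\<lambda>x. (\<Sum>i\<in>A. f i (x i))\<^sup>2)"
    unfolding square using cross by (intro Bochner_Integration.integrable_sum) auto
  have "measure_pmf.expectation (Pi_pmf A d D) (\<lambda>x. (\<Sum>i\<in>A. f i (x i))\<^sup>2)
      = (\<Sum>i\<in>A. \<Sum>j\<in>A. if i = j then ?v i else ?e i * ?e j)"
    unfolding square using cross by (simp add: Bochner_Integration.integral_sum)
  also have "\<dots> \<le> (\<Sum>i\<in>A. \<Sum>j\<in>A. ?e i * ?e j + (if i = j then ?v i else 0))"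
    by (intro sum_mono) auto
  also have "\<dots> = (\<Sum>i\<in>A. ?e i)\<^sup>2 + (\<Sum>i\<in>A. ?v i)"
    using assms(1) by (simp add: sum.distrib power2_eq_square sum_product)
  finally show "measure_pmf.expectation (Pi_pmf A d D) (\<lambda>x. (\<Sum>i\<in>A. f i (x i))\<^sup>2)
      \<le> (\<Sum>i\<in>A. ?e i)\<^sup>2 + (\<Sum>i\<in>A. ?v i)" .
qed

section \<open>The error of one coordinate\<close>

text \<open>
  Here \<open>p\<close> is the true mass, \<open>q\<close> the reference mass and \<open>k\<close> the observed count. Summed over the
  coordinates, these terms make up the estimation error.
\<close>

definition coord_error :: "nat \<Rightarrow> real \<Rightarrow> real \<Rightarrow> nat \<Rightarrow> real" where
  "coord_error n q p k = \<bar>real k / real n - q\<bar> - \<bar>p - q\<bar>"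

lemma coord_error_eq:
  assumes "0 < n"
  shows "coord_error n q p k = (\<bar>real k - real n * q\<bar> - \<bar>real n * p - real n * q\<bar>) / real n"
proof -
  have "\<bar>real k - real n * q\<bar> = real n * \<bar>real k / real n - q\<bar>"
    using assms by (simp add: abs_mult_pos' field_simps)
  moreover have "\<bar>real n * p - real n * q\<bar> = real n * \<bar>p - q\<bar>"
    by (simp add: abs_mult flip: right_diff_distrib)
  ultimately show ?thesis using assms by (simp add: coord_error_def field_simps)
qed

lemma expectation_coord_error:
  assumes "0 < n" and "0 \<le> p"
  shows "measure_pmf.expectation (poi (real n * p)) (coord_error n q p)
      = (measure_pmf.expectation (poi (real n * p)) (\<lambda>k. \<bar>real k - real n * q\<bar>)
          - \<bar>real n * p - real n * q\<bar>) / real n"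
  unfolding coord_error_eq[OF assms(1), abs_def]
  using assms integrable_poi_abs[of "real n * p"] by simp

lemma scaled_min_sqrt:
  assumes "0 < n"
  shows "min (real n * q) (sqrt (real n * q)) / real n = min q (sqrt (q / real n))"
proof -
  have "sqrt (real n * q) / real n = sqrt (q / real n)"
    using assms by (simp add: real_sqrt_mult real_sqrt_divide field_simps)
  then show ?thesis using assms by (simp add: min_divide_distrib_right)
qed

text \<open>
  The bias of one coordinate, bounded uniformly in the true mass \<open>p\<close>; the uniformity is what makes
  the upper bound in the theorem depend on \<open>q\<close> and \<open>n\<close> alone.
\<close>

lemma abs_expectation_coord_error_le:
  assumes "0 < n" and "0 \<le> p" and "0 \<le> q"
  shows "\<bar>measure_pmf.expectation (poi (real n * p)) (coord_error n q p)\<bar>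
      \<le> 2 * min q (sqrt (q / real n))"
  using poi_mean_abs_shift_ge[of "real n * p" "real n * q"]
    poi_mean_abs_shift_le[of "real n * p" "real n * q"] assms
  by (simp add: expectation_coord_error scaled_min_sqrt[symmetric] divide_right_mono)

text \<open>
  Since \<open>v \<mapsto> \<bar>v - q\<bar>\<close> is a contraction, the error is dominated by that of the empirical mass itself,
  whose second moment is the Poisson variance \<open>n p\<close> divided by \<open>n\<^sup>2\<close>.
\<close>

lemma
  assumes "0 < n" and "0 \<le> p"
  shows coord_error_square_integrable:
      "integrable (measure_pmf (poi (real n * p))) (\<lambda>k. (coord_error n q p k)\<^sup>2)"
    and coord_error_second_moment_le:
      "measure_pmf.expectation (poi (real n * p)) (\<lambda>k. (coord_error n q p k)\<^sup>2) \<le> p / real n"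
proof -
  let ?r = "real n * p"
  have bound: "(coord_error n q p k)\<^sup>2 \<le> (real k - ?r)\<^sup>2 / (real n)\<^sup>2" for k
  proof -
    have "\<bar>\<bar>real k - real n * q\<bar> - \<bar>?r - real n * q\<bar>\<bar> \<le> \<bar>real k - ?r\<bar>" by linarith
    then show ?thesis
      by (simp add: coord_error_eq[OF assms(1)] power_divide divide_right_mono abs_le_square_iff[symmetric])
  qed
  have moment: "has_bochner_integral (poi ?r) (\<lambda>k. (real k - ?r)\<^sup>2 / (real n)\<^sup>2) (?r / (real n)\<^sup>2)"
    using poi_centered_second_moment[of ?r ?r] assms(2) by (auto intro: has_bochner_integral_divide_zero)
  show int: "integrable (measure_pmf (poi ?r)) (\<lambda>k. (coord_error n q p k)\<^sup>2)"
    by (rule Bochner_Integration.integrable_bound[OF integrable.intros[OF moment]]) (use bound in auto)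
  have "measure_pmf.expectation (poi ?r) (\<lambda>k. (coord_error n q p k)\<^sup>2) \<le> ?r / (real n)\<^sup>2"
    using integral_mono[OF int integrable.intros[OF moment] bound]
    unfolding has_bochner_integral_integral_eq[OF moment] .
  then show "measure_pmf.expectation (poi ?r) (\<lambda>k. (coord_error n q p k)\<^sup>2) \<le> p / real n"
    using assms(1) by (simp add: power2_eq_square)
qed

section \<open>The risk of the plug-in estimator\<close>

lemma plugin_risk_eq_second_moment:
  assumes "0 < n" and "\<And>i. i \<in> {1..S} \<Longrightarrow> 0 \<le> p i"
  shows "plugin_risk S n q p = ennreal (measure_pmf.expectation (poisson_sampling S n p)
           (\<lambda>x. (\<Sum>i=1..S. coord_error n (q i) (p i) (x i))\<^sup>2))"
proof -
  have "(l1_dist S (empirical n x) q - l1_dist S p q) = (\<Sum>i=1..S. coord_error n (q i) (p i) (x i))" for x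
    by (simp add: l1_dist_def empirical_def coord_error_def sum_subtractf)
  then have "plugin_risk S n q p = (\<integral>\<^sup>+ x. ennreal ((\<Sum>i=1..S. coord_error n (q i) (p i) (x i))\<^sup>2)
      \<partial>measure_pmf (poisson_sampling S n p))"
    by (simp add: plugin_risk_def)
  also have "\<dots> = ennreal (measure_pmf.expectation (poisson_sampling S n p)
           (\<lambda>x. (\<Sum>i=1..S. coord_error n (q i) (p i) (x i))\<^sup>2))"
    unfolding poisson_sampling_def using assms
    by (intro nn_integral_eq_integral sum_coordinates_Pi_pmf_square_integrable
        coord_error_square_integrable) auto
  finally show ?thesis .
qed

lemma plugin_risk_le:
  assumes "0 < n" and "p \<in> prob_vectors S" and "q \<in> prob_vectors S"
  shows "plugin_risk S n q p \<le> ennreal (4 * (\<Sum>i=1..S. min (q i) (sqrt (q i / real n)))\<^sup>2 + 1 / real n)"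
proof -
  let ?D = "\<lambda>i. poi (real n * p i)"
  let ?f = "\<lambda>i. coord_error n (q i) (p i)"
  let ?m = "\<lambda>i. min (q i) (sqrt (q i / real n))"
  have nonneg: "0 \<le> p i" "0 \<le> q i" if "i \<in> {1..S}" for i
    using that assms(2,3) by (auto simp: prob_vectors_def)
  have "measure_pmf.expectation (poisson_sampling S n p) (\<lambda>x. (\<Sum>i=1..S. ?f i (x i))\<^sup>2)
      \<le> (\<Sum>i=1..S. measure_pmf.expectation (?D i) (?f i))\<^sup>2
        + (\<Sum>i=1..S. measure_pmf.expectation (?D i) (\<lambda>k. (?f i k)\<^sup>2))"
    unfolding poisson_sampling_def using assms(1) nonneg
    by (intro sum_coordinates_Pi_pmf_second_moment_le coord_error_square_integrable) auto
  also have "\<dots> \<le> (2 * (\<Sum>i=1..S. ?m i))\<^sup>2 + 1 / real n"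
  proof (rule add_mono)
    have "\<bar>\<Sum>i=1..S. measure_pmf.expectation (?D i) (?f i)\<bar> \<le> (\<Sum>i=1..S. 2 * ?m i)"
      using assms(1) nonneg
      by (intro order_trans[OF sum_abs] sum_mono abs_expectation_coord_error_le) auto
    then show "(\<Sum>i=1..S. measure_pmf.expectation (?D i) (?f i))\<^sup>2 \<le> (2 * (\<Sum>i=1..S. ?m i))\<^sup>2"
      by (simp add: abs_le_square_iff[symmetric] sum_distrib_left)
    have "(\<Sum>i=1..S. measure_pmf.expectation (?D i) (\<lambda>k. (?f i k)\<^sup>2)) \<le> (\<Sum>i=1..S. p i / real n)"
      using assms(1) nonneg by (intro sum_mono coord_error_second_moment_le) auto
    also have "\<dots> = 1 / real n"
      using assms(2) by (simp add: prob_vectors_def flip: sum_divide_distrib)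
    finally show "(\<Sum>i=1..S. measure_pmf.expectation (?D i) (\<lambda>k. (?f i k)\<^sup>2)) \<le> 1 / real n" .
  qed
  finally show ?thesis
    using assms(1) nonneg(1)
    by (subst plugin_risk_eq_second_moment)
      (auto intro!: ennreal_leI simp: power_mult_distrib simp del: ennreal_plus)
qed

text \<open>
  At \<open>P = Q\<close> the biases of all coordinates are mean absolute deviations, hence all as large as
  possible up to a constant and of the same sign; the bias alone gives the bound.
\<close>

lemma plugin_risk_self_ge:
  assumes "0 < n" and "q \<in> prob_vectors S"
  shows "ennreal (1 / 2 * (\<Sum>i=1..S. min (q i) (sqrt (q i / real n)))\<^sup>2) \<le> plugin_risk S n q q"
proof -
  let ?M = "poisson_sampling S n q"
  let ?m = "\<lambda>i. min (q i) (sqrt (q i / real n))"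
  let ?f = "\<lambda>i. coord_error n (q i) (q i)"
  let ?Z = "\<lambda>x. \<Sum>i=1..S. ?f i (x i)"
  have nonneg: "0 \<le> q i" if "i \<in> {1..S}" for i
    using that assms(2) by (auto simp: prob_vectors_def)
  have sq: "integrable (measure_pmf (poi (real n * q i))) (\<lambda>k. (?f i k)\<^sup>2)" if "i \<in> {1..S}" for i
    using assms(1) nonneg[OF that] by (rule coord_error_square_integrable)
  note sums = sum_coordinates_Pi_pmf_integrable sum_coordinates_Pi_pmf_expectation
    sum_coordinates_Pi_pmf_square_integrable
  note Z = sums[of "{1..S}" "\<lambda>i. poi (real n * q i)" ?f 0, OF _ sq, folded poisson_sampling_def]
  have "?m i / sqrt 2 \<le> measure_pmf.expectation (poi (real n * q i)) (?f i)" if "i \<in> {1..S}" for i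
    using poi_mean_abs_deviation_lower_bound[of "real n * q i"] assms(1) nonneg[OF that]
    by (simp add: expectation_coord_error scaled_min_sqrt[symmetric] field_simps)
  then have "(\<Sum>i=1..S. ?m i) / sqrt 2 \<le> measure_pmf.expectation ?M ?Z"
    by (subst Z(2)) (auto simp: sum_divide_distrib intro!: sum_mono)
  then have "((\<Sum>i=1..S. ?m i) / sqrt 2)\<^sup>2 \<le> (measure_pmf.expectation ?M ?Z)\<^sup>2"
    using nonneg by (intro power_mono) (auto intro!: sum_nonneg divide_nonneg_nonneg)
  also have "\<dots> \<le> measure_pmf.expectation ?M (\<lambda>x. (?Z x)\<^sup>2)"
    using measure_pmf.variance_positive[of ?M ?Z] measure_pmf.variance_eq[of ?M ?Z, OF Z(1,3)]
    by (simp del: Bochner_Integration.integral_nonneg)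
  finally show ?thesis
    using assms(1) nonneg
    by (subst plugin_risk_eq_second_moment) (auto intro!: ennreal_leI simp: power_divide)
qed

theorem theorem1:
  fixes S n :: nat and q :: "nat \<Rightarrow> real"
  assumes "S > 0" and "n > 0" and "q \<in> prob_vectors S"
  shows "(SUP p\<in>prob_vectors S. plugin_risk S n q p)
           \<le> ennreal (4 * (\<Sum>i=1..S. min (q i) (sqrt (q i / real n)))\<^sup>2 + 1 / real n)
       \<and> (SUP p\<in>prob_vectors S. plugin_risk S n q p)
           \<ge> ennreal (1 / 2 * (\<Sum>i=1..S. min (q i) (sqrt (q i / real n)))\<^sup>2)"
proof
  show "(SUP p\<in>prob_vectors S. plugin_risk S n q p)
      \<le> ennreal (4 * (\<Sum>i=1..S. min (q i) (sqrt (q i / real n)))\<^sup>2 + 1 / real n)"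
    using assms(2,3) by (intro SUP_least plugin_risk_le)
  show "(SUP p\<in>prob_vectors S. plugin_risk S n q p)
      \<ge> ennreal (1 / 2 * (\<Sum>i=1..S. min (q i) (sqrt (q i / real n)))\<^sup>2)"
    using assms(2,3) by (intro SUP_upper2[OF assms(3)] plugin_risk_self_ge)
qed

end
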